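(* Let $(X,d)$ be an ultrametric space. Then $(\bar{\mathbf{B}}_X, d_H)$ is compact if and only if $(X,d)$ is compact.
   Context: Metric spaces are nonempty. An ultrametric space is a metric space $(X,d)$ with $d(x,y)\le\max\{d(x,z),d(z,y)\}$ for all $x,y,z\in X$. For $c\in X$ and $r\ge 0$ the closed ball is $\bar B_r(c)=\{x\in X: d(c,x)\le r\}$ (so $\bar B_0(c)=\{c\}$). $\bar{\mathbf{B}}_X$ is the set of all closed balls $\bar B_r(c)$, $c\in X$, $r\ge 0$, regarded as subsets of $X$. The Hausdorff distance between nonempty closed bounded sets $A,B\subseteq X$ is $d_H(A,B)=\max\{\sup_{a\in A}\inf_{b\in B}d(a,b),\ \sup_{b\in B}\inf_{a\in A}d(a,b)\}$; $\bar{\mathbf{B}}_X$ is equipped with the metric $d_H$. *)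

theory Defs
  imports "HOL-Analysis.Analysis"
begin

locale Ultrametric_space = Metric_space +
  assumes nonempty: "M \<noteq> {}"
    and ultrametric: "\<And>x y z. \<lbrakk>x \<in> M; y \<in> M; z \<in> M\<rbrakk> \<Longrightarrow> d x y \<le> max (d x z) (d z y)"

context Metric_space
begin

definition closed_balls :: "'a set set" where
  "closed_balls = {mcball c r | c r. c \<in> M \<and> 0 \<le> r}"

definition closed_bounded_sets :: "'a set set" where
  "closed_bounded_sets = {A. A \<noteq> {} \<and> closedin mtopology A \<and> mbounded A}"

text \<open>
  The locale \<^locale>\<open>Metric_space\<close> requires symmetry and nonnegativity of the distance on the
  whole type, not just on the carrier. Hence the value 0 outside the domain of the Hausdorff
  distance, where real suprema and infima are unspecified.
\<close>

definition hausdorff_dist :: "'a set \<Rightarrow> 'a set \<Rightarrow> real" where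
  "hausdorff_dist A B =
     (if A \<in> closed_bounded_sets \<and> B \<in> closed_bounded_sets
      then max (SUP a\<in>A. INF b\<in>B. d a b) (SUP b\<in>B. INF a\<in>A. d a b)
      else 0)"

lemma closed_balls_subset: "closed_balls \<subseteq> closed_bounded_sets"
  by (auto simp: closed_balls_def closed_bounded_sets_def mbounded_mcball mcball_eq_empty)

lemma hausdorff_commute: "hausdorff_dist A B = hausdorff_dist B A"
  unfolding hausdorff_dist_def by (simp add: commute max.commute)

lemma bdd_below_dist: "bdd_below (d a ` B)"
  by (rule bdd_belowI[of _ 0]) auto

lemma Inf_dist_nonneg: "B \<noteq> {} \<Longrightarrow> 0 \<le> (INF b\<in>B. d a b)"
  by (rule cINF_greatest) auto

lemma bdd_above_Inf_dist:
  assumes "A \<in> closed_bounded_sets" "B \<in> closed_bounded_sets"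
  shows "bdd_above ((\<lambda>a. INF b\<in>B. d a b) ` A)"
proof -
  have "mbounded (A \<union> B)" and ne: "B \<noteq> {}"
    using assms by (auto simp: closed_bounded_sets_def mbounded_Un)
  then obtain r where r: "\<forall>x \<in> A \<union> B. \<forall>y \<in> A \<union> B. d x y \<le> r"
    unfolding mbounded_alt by blast
  obtain b where "b \<in> B" using ne by blast
  then have "(INF b\<in>B. d a b) \<le> r" if "a \<in> A" for a
    using r that cINF_lower[OF bdd_below_dist, of b B a] by force
  then show ?thesis by (auto intro!: bdd_aboveI2)
qed

lemma Inf_dist_le_hausdorff:
  assumes "A \<in> closed_bounded_sets" "B \<in> closed_bounded_sets" "a \<in> A"
  shows "(INF b\<in>B. d a b) \<le> hausdorff_dist A B"
proof -
  have "(INF b\<in>B. d a b) \<le> (SUP a\<in>A. INF b\<in>B. d a b)"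
    using bdd_above_Inf_dist[OF assms(1,2)] assms(3) by (rule cSUP_upper2) simp
  then show ?thesis using assms by (simp add: hausdorff_dist_def)
qed

lemma hausdorff_nonneg: "0 \<le> hausdorff_dist A B"
proof (cases "A \<in> closed_bounded_sets \<and> B \<in> closed_bounded_sets")
  case True
  then obtain a where "a \<in> A" "B \<noteq> {}" by (auto simp: closed_bounded_sets_def)
  then show ?thesis
    using Inf_dist_le_hausdorff[of A B a] Inf_dist_nonneg[of B a] True by linarith
next
  case False
  then show ?thesis unfolding hausdorff_dist_def by auto
qed

lemma hausdorff_least:
  assumes "A \<in> closed_bounded_sets" "B \<in> closed_bounded_sets"
    and "\<And>a. a \<in> A \<Longrightarrow> (INF b\<in>B. d a b) \<le> r"
    and "\<And>b. b \<in> B \<Longrightarrow> (INF a\<in>A. d b a) \<le> r"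
  shows "hausdorff_dist A B \<le> r"
proof -
  have ne: "A \<noteq> {}" "B \<noteq> {}" using assms by (auto simp: closed_bounded_sets_def)
  have "(SUP a\<in>A. INF b\<in>B. d a b) \<le> r" "(SUP b\<in>B. INF a\<in>A. d b a) \<le> r"
    using ne assms by (auto intro!: cSUP_least)
  then show ?thesis using assms by (simp add: hausdorff_dist_def commute)
qed

lemma Inf_dist_triangle:
  assumes A: "A \<in> closed_bounded_sets" and B: "B \<in> closed_bounded_sets"
    and C: "C \<in> closed_bounded_sets" and a: "a \<in> A"
  shows "(INF c\<in>C. d a c) \<le> hausdorff_dist A B + hausdorff_dist B C"
proof -
  have ne: "B \<noteq> {}" "C \<noteq> {}" and sub: "A \<subseteq> M" "B \<subseteq> M" "C \<subseteq> M"
    using A B C by (auto simp: closed_bounded_sets_def dest: mbounded_subset_mspace)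
  have "(INF c\<in>C. d a c) - hausdorff_dist B C \<le> d a b" if b: "b \<in> B" for b
  proof -
    have "(INF c\<in>C. d a c) - d a b \<le> (INF c\<in>C. d b c)"
    proof (rule cINF_greatest[OF ne(2)])
      fix c assume c: "c \<in> C"
      have "(INF c\<in>C. d a c) \<le> d a c" using c by (intro cINF_lower bdd_below_dist)
      also have "\<dots> \<le> d a b + d b c" using a b c sub by (intro triangle) auto
      finally show "(INF c\<in>C. d a c) - d a b \<le> d b c" by simp
    qed
    with Inf_dist_le_hausdorff[OF B C b] show ?thesis by linarith
  qed
  then have "(INF c\<in>C. d a c) - hausdorff_dist B C \<le> (INF b\<in>B. d a b)"
    by (intro cINF_greatest ne(1))
  with Inf_dist_le_hausdorff[OF A B a] show ?thesis by linarith
qed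

lemma hausdorff_zero_subset:
  assumes A: "A \<in> closed_bounded_sets" and B: "B \<in> closed_bounded_sets"
    and 0: "hausdorff_dist A B = 0"
  shows "A \<subseteq> B"
proof
  fix a assume a: "a \<in> A"
  have ne: "B \<noteq> {}" and cl: "closedin mtopology B" and sub: "A \<subseteq> M" "B \<subseteq> M"
    using A B by (auto simp: closed_bounded_sets_def dest: mbounded_subset_mspace)
  have *: "(INF b\<in>B. d a b) \<le> 0" using Inf_dist_le_hausdorff[OF A B a] 0 by simp
  have "\<exists>b\<in>B. b \<in> mball a r" if "r > 0" for r
  proof -
    have "(INF b\<in>B. d a b) < r" using * that by linarith
    then obtain b where "b \<in> B" "d a b < r"
      using cINF_less_iff[OF ne bdd_below_dist] by blast
    then show ?thesis using a sub by auto
  qed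
  then have "a \<in> mtopology closure_of B"
    using a sub by (auto simp: metric_closure_of)
  then show "a \<in> B" using cl by (simp add: closure_of_closedin)
qed

lemma Metric_space_hausdorff: "Metric_space closed_bounded_sets hausdorff_dist"
proof
  show "0 \<le> hausdorff_dist A B" for A B by (rule hausdorff_nonneg)
  show "hausdorff_dist A B = hausdorff_dist B A" for A B by (rule hausdorff_commute)
next
  fix A B assume A: "A \<in> closed_bounded_sets" and B: "B \<in> closed_bounded_sets"
  have "(INF b\<in>A. d a b) \<le> 0" if a: "a \<in> A" for a
  proof -
    have "a \<in> M" using A a by (auto simp: closed_bounded_sets_def dest: mbounded_subset_mspace)
    then show ?thesis using cINF_lower[OF bdd_below_dist a, of a] by simp
  qed
  then have "hausdorff_dist A A \<le> 0" by (intro hausdorff_least[OF A A])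
  then have "hausdorff_dist A A = 0" using hausdorff_nonneg[of A A] by simp
  then show "hausdorff_dist A B = 0 \<longleftrightarrow> A = B"
    using hausdorff_zero_subset[OF A B] hausdorff_zero_subset[OF B A] hausdorff_commute[of A B]
    by auto
next
  fix A B C
  assume A: "A \<in> closed_bounded_sets" and B: "B \<in> closed_bounded_sets"
    and C: "C \<in> closed_bounded_sets"
  show "hausdorff_dist A C \<le> hausdorff_dist A B + hausdorff_dist B C"
    using Inf_dist_triangle[OF A B C] Inf_dist_triangle[OF C B A]
    by (intro hausdorff_least[OF A C]) (auto simp: hausdorff_commute add.commute)
qed

lemma Metric_space_closed_balls: "Metric_space closed_balls hausdorff_dist"
  using Metric_space.subspace[OF Metric_space_hausdorff closed_balls_subset] .

end

end

theory Submission
  imports Defs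
begin

text \<open>
  The isometric embedding \<open>x \<mapsto> {x}\<close> drives both directions. If a sequence of singletons
  \<open>{x\<^sub>n}\<close> converges to a ball \<open>B\<close>, then \<open>x\<^sub>n\<close> converges to every point of \<open>B\<close>.
  Conversely, let \<open>X\<close> be compact and let an open cover of the space of balls be given. Finitely many
  members cover the compact set of singletons, hence, by the Lebesgue number lemma, all balls of
  radius less than some \<open>\<epsilon> > 0\<close>. Only finitely many balls remain, since a ball of radius at least
  \<open>\<epsilon>\<close> is a union of members of a finite cover of \<open>X\<close> by open balls of radius \<open>\<epsilon>\<close>.
\<close>

context Metric_space
begin

lemma singleton_in_closed_balls:
  assumes "x \<in> M"
  shows "{x} \<in> closed_balls"
proof -
  have "d x y \<le> 0 \<longleftrightarrow> x = y" if "y \<in> M" for y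
    using assms that nonneg[of x y] zero[of x y] by linarith
  then have "mcball x 0 = {x}" using assms by auto
  with assms show ?thesis unfolding closed_balls_def by force
qed

text \<open>An infimum over the one-point set \<open>{a}\<close> is just the distance to
  \<open>a\<close>, so one of the two suprema in the Hausdorff distance already dominates every
  \<open>d a b\<close>.\<close>

lemma dist_le_hausdorff_singleton:
  assumes "a \<in> M" "B \<in> closed_bounded_sets" "b \<in> B"
  shows "d a b \<le> hausdorff_dist {a} B"
  using Inf_dist_le_hausdorff[of B "{a}" b] assms closed_balls_subset
    singleton_in_closed_balls[OF assms(1)]
  by (auto simp: commute hausdorff_commute)

text \<open>Of the two one-sided terms, the one from \<open>B\<close> to \<open>{a}\<close> consists
  of the distances \<open>d a b\<close> themselves; the one from \<open>a\<close> to
  \<open>B\<close> is an infimum, hence at most any single \<open>d a b\<close>, and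
  \<open>B\<close> is nonempty. With the previous lemma, the distance from \<open>{a}\<close> to
  \<open>B\<close> is the supremum of \<open>d a b\<close> over \<open>B\<close>.\<close>

lemma hausdorff_singleton_le:
  assumes "a \<in> M" and B: "B \<in> closed_bounded_sets" and le: "\<And>b. b \<in> B \<Longrightarrow> d a b \<le> r"
  shows "hausdorff_dist {a} B \<le> r"
proof (rule hausdorff_least[OF _ B])
  show "{a} \<in> closed_bounded_sets"
    using singleton_in_closed_balls[OF assms(1)] closed_balls_subset by blast
next
  fix x assume "x \<in> {a}"
  obtain b where "b \<in> B" using B by (auto simp: closed_bounded_sets_def)
  then have "(INF b\<in>B. d a b) \<le> d a b" by (intro cINF_lower bdd_below_dist)
  with \<open>b \<in> B\<close> \<open>x \<in> {a}\<close> le show "(INF b\<in>B. d x b) \<le> r" by fastforce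
next
  fix b assume "b \<in> B"
  then show "(INF x\<in>{a}. d b x) \<le> r" using le by (simp add: commute[of b])
qed

lemma continuous_map_singleton:
  "continuous_map mtopology (Metric_space.mtopology closed_balls hausdorff_dist) (\<lambda>x. {x})"
proof -
  interpret B: Metric_space closed_balls hausdorff_dist by (rule Metric_space_closed_balls)
  have "hausdorff_dist {x} {y} \<le> d x y" if "x \<in> M" "y \<in> M" for x y
    using that singleton_in_closed_balls closed_balls_subset
    by (intro hausdorff_singleton_le) auto
  then show ?thesis
    unfolding metric_continuous_map[OF Metric_space_closed_balls]
    by (metis image_subsetI order.strict_trans1 singleton_in_closed_balls)
qed

lemma compact_space_of_compact_closed_balls:
  assumes "compact_space (Metric_space.mtopology closed_balls hausdorff_dist)"
  shows "compact_space mtopology"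
proof -
  interpret B: Metric_space closed_balls hausdorff_dist by (rule Metric_space_closed_balls)
  have "\<exists>l r. l \<in> M \<and> strict_mono r \<and> limitin mtopology (\<sigma> \<circ> r) l sequentially"
    if \<sigma>: "range \<sigma> \<subseteq> M" for \<sigma> :: "nat \<Rightarrow> 'a"
  proof -
    have "range (\<lambda>n. {\<sigma> n}) \<subseteq> closed_balls"
      using \<sigma> singleton_in_closed_balls by blast
    then obtain B r where r: "strict_mono r"
      and lim: "limitin B.mtopology ((\<lambda>n. {\<sigma> n}) \<circ> r) B sequentially"
      using assms unfolding B.compact_space_sequentially by blast
    then have B: "B \<in> closed_bounded_sets"
      using B.limitin_mspace closed_balls_subset by blast
    \<comment> \<open>Any point of the limit ball serves as a limit in \<open>M\<close>, since the
      Hausdorff distance from \<open>{\<sigma> n}\<close> bounds the distance to every point of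
      \<open>B\<close>.\<close>
    then obtain b where b: "b \<in> B" "b \<in> M"
      unfolding closed_bounded_sets_def using mbounded_subset_mspace by blast
    have le: "d (\<sigma> n) b \<le> hausdorff_dist {\<sigma> n} B" for n
      using dist_le_hausdorff_singleton \<sigma> B b by blast
    have "limitin mtopology (\<sigma> \<circ> r) b sequentially"
      unfolding limitin_metric
    proof (intro conjI allI impI)
      fix \<epsilon> :: real assume "\<epsilon> > 0"
      with lim have "\<forall>\<^sub>F n in sequentially. hausdorff_dist {\<sigma> (r n)} B < \<epsilon>"
        unfolding B.limitin_metric by (auto elim: eventually_mono)
      then show "\<forall>\<^sub>F n in sequentially. (\<sigma> \<circ> r) n \<in> M \<and> d ((\<sigma> \<circ> r) n) b < \<epsilon>"
        by (rule eventually_mono) (use \<sigma> le_less_trans[OF le] in auto)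
    qed (rule b)
    with r b show ?thesis by blast
  qed
  then show ?thesis unfolding compact_space_sequentially by blast
qed

end

context Ultrametric_space
begin

text \<open>A ball of radius at least \<open>\<epsilon>\<close> is determined by which centres of a
  finite \<open>\<epsilon>\<close>-net lie in it, so there are at most as many such balls as subsets
  of the net.\<close>

lemma finite_large_closed_balls:
  assumes "mtotally_bounded M" "\<epsilon> > 0"
  shows "finite {mcball c r | c r. c \<in> M \<and> \<epsilon> \<le> r}"
proof -
  obtain K where K: "finite K" "K \<subseteq> M" "M \<subseteq> (\<Union>k\<in>K. mball k \<epsilon>)"
    using assms by (auto simp: mtotally_bounded_def)
  have "mcball c r \<in> (\<lambda>L. \<Union>k\<in>L. mball k \<epsilon>) ` Pow K" if c: "c \<in> M" and r: "\<epsilon> \<le> r" for c r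
  proof
    \<comment> \<open>Steps shorter than \<open>\<epsilon>\<close> cannot leave the ball:
      \<open>d c y\<close> is at most the maximum of \<open>d c x \<le> r\<close> and
      \<open>d x y < \<epsilon> \<le> r\<close>. One inclusion below moves from a point to its net
      centre, the other from a net centre to a point.\<close>
    have near: "y \<in> mcball c r" if "x \<in> mcball c r" "x \<in> M" "y \<in> M" "d x y < \<epsilon>" for x y
      using ultrametric[OF c \<open>y \<in> M\<close> \<open>x \<in> M\<close>] that c r by (simp add: max_def split: if_splits)
    show "mcball c r = (\<Union>k\<in>K \<inter> mcball c r. mball k \<epsilon>)"
    proof
      show "mcball c r \<subseteq> (\<Union>k\<in>K \<inter> mcball c r. mball k \<epsilon>)"
      proof
        fix x assume x: "x \<in> mcball c r"
        then have "x \<in> M" by simp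
        with K obtain k where "k \<in> K" "x \<in> mball k \<epsilon>" by blast
        with near[of x k] x show "x \<in> (\<Union>k\<in>K \<inter> mcball c r. mball k \<epsilon>)"
          by (auto simp: commute[of x k])
      qed
      show "(\<Union>k\<in>K \<inter> mcball c r. mball k \<epsilon>) \<subseteq> mcball c r"
        using near by fastforce
    qed
  qed auto
  then have "{mcball c r | c r. c \<in> M \<and> \<epsilon> \<le> r} \<subseteq> (\<lambda>L. \<Union>k\<in>L. mball k \<epsilon>) ` Pow K"
    by blast
  with K(1) show ?thesis by (meson finite_Pow_iff finite_imageI finite_subset)
qed

lemma compact_closed_balls_of_compact_space:
  assumes "compact_space mtopology"
  shows "compact_space (Metric_space.mtopology closed_balls hausdorff_dist)"
proof -
  interpret B: Metric_space closed_balls hausdorff_dist by (rule Metric_space_closed_balls)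
  let ?S = "(\<lambda>x. {x}) ` M"
  have cpt: "compactin B.mtopology ?S"
    using image_compactin[OF _ continuous_map_singleton, of M] assms
    by (simp add: compact_space_def)
  have "\<exists>\<F>. finite \<F> \<and> \<F> \<subseteq> \<U> \<and> closed_balls \<subseteq> \<Union>\<F>"
    if op: "\<And>U. U \<in> \<U> \<Longrightarrow> openin B.mtopology U" and cov: "closed_balls \<subseteq> \<Union>\<U>" for \<U>
  proof -
    have "?S \<subseteq> \<Union>\<U>" using cov singleton_in_closed_balls by blast
    then obtain \<F> where \<F>: "finite \<F>" "\<F> \<subseteq> \<U>" "?S \<subseteq> \<Union>\<F>"
      using cpt op by (meson compactinD)
    \<comment> \<open>The Lebesgue number is taken in the space of balls, for the compact set
      \<open>?S\<close>: each \<open>{x}\<close> has its whole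
      \<open>\<epsilon>\<close>-neighbourhood of balls inside one member of
      \<open>\<F>\<close>.\<close>
    then obtain \<epsilon> where "\<epsilon> > 0" and \<epsilon>: "\<And>x. x \<in> M \<Longrightarrow> \<exists>U\<in>\<F>. B.mball {x} \<epsilon> \<subseteq> U"
      using B.lebesgue_number[OF cpt, of \<F>] op by (metis imageI subsetD)
    let ?L = "{mcball c r | c r. c \<in> M \<and> \<epsilon> \<le> r}"
    have "\<forall>A\<in>closed_balls. \<exists>U. U \<in> \<U> \<and> A \<in> U" using cov by blast
    then obtain f where f: "\<And>A. A \<in> closed_balls \<Longrightarrow> f A \<in> \<U> \<and> A \<in> f A"
      unfolding bchoice_iff by blast
    have L: "?L \<subseteq> closed_balls" unfolding closed_balls_def using \<open>\<epsilon> > 0\<close> by force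
    have "finite ?L"
      using finite_large_closed_balls \<open>\<epsilon> > 0\<close> assms
        compact_space_eq_mcomplete_mtotally_bounded by blast
    moreover have "A \<in> \<Union>(\<F> \<union> f ` ?L)" if A: "A \<in> closed_balls" for A
    proof (cases "A \<in> ?L")
      case True
      with f[OF A] show ?thesis by blast
    next
      case False
      \<comment> \<open>A ball may have several centres and radii; as \<open>A\<close> lies outside
        \<open>?L\<close>, every representation of it has radius below
        \<open>\<epsilon>\<close>.\<close>
      with A obtain c r where c: "c \<in> M" and r: "r < \<epsilon>" and Aeq: "A = mcball c r"
        unfolding closed_balls_def by force
      \<comment> \<open>All points of \<open>A\<close> are within \<open>r\<close> of
        \<open>c\<close>, and \<open>r < \<epsilon>\<close> strictly, so \<open>A\<close> falls in
        the open Hausdorff ball around \<open>{c}\<close>.\<close>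
      have "hausdorff_dist {c} A \<le> r"
        using c A Aeq closed_balls_subset by (intro hausdorff_singleton_le) auto
      then have "A \<in> B.mball {c} \<epsilon>"
        using A c r singleton_in_closed_balls by auto
      with \<epsilon>[OF c] show ?thesis by blast
    qed
    moreover have "\<F> \<union> f ` ?L \<subseteq> \<U>" using \<F> f L by blast
    ultimately show ?thesis using \<F>(1) by (intro exI[of _ "\<F> \<union> f ` ?L"]) blast
  qed
  then show ?thesis unfolding compact_space_def compactin_def by simp
qed

end

theorem corollary5p13:
  fixes X :: "'a set" and d :: "'a \<Rightarrow> 'a \<Rightarrow> real"
  assumes "Ultrametric_space X d"
  shows "compact_space (Metric_space.mtopology (Metric_space.closed_balls X d)
            (Metric_space.hausdorff_dist X d))
         \<longleftrightarrow> compact_space (Metric_space.mtopology X d)"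
proof -
  interpret Ultrametric_space X d by (rule assms)
  show ?thesis
    using compact_space_of_compact_closed_balls compact_closed_balls_of_compact_space by blast
qed

end
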